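(* The following hold. (i) For every real number $r \ge 0$ there exists a Dirichlet series $f(s)=\sum_{n=1}^\infty a_n n^{-s}$ with $a_n>0$ for all $n\ge 1$ such that $\sigma_a(f)-\delta_a(f)=r$. (ii) For every real number $r\ge 1$ there exists a Dirichlet series $f(s)=\sum_{n=1}^\infty a_n n^{-s}$ with multiplicative coefficients (i.e. $a_{mn}=a_m a_n$ whenever $\gcd(m,n)=1$) such that $\sigma_a(f)-\delta_a(f)=r$.
   Context: For a Dirichlet series $f(s)=\sum_{n=1}^\infty a_n n^{-s}$ ($a_n\in\mathbb C$, $s$ complex), the abscissa of absolute convergence is $\sigma_a(f)=\inf\{\sigma\in\mathbb R : \sum_{n=1}^\infty |a_n| n^{-\sigma}<\infty\}$. Let $\{p_j\}_{j\ge1}$ be the increasing enumeration of the prime numbers. For an integer $n\ge 2$, $\mathbf{gpf}(n)$ denotes the greatest prime factor of $n$, and $\mathbf{gpf}(1)=1$. Define $$\delta_a(f)=\inf\Big\{\sigma\in\mathbb R : \sum_{\substack{j\ge 1\\ \mathbf{gpf}(j)\le p_n}} |a_j| j^{-\sigma}<\infty \text{ for all } n\in\mathbb N\Big\}.$$ *)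

theory Defs
  imports "HOL-Analysis.Analysis" "HOL-Computational_Algebra.Primes"
begin

text \<open>
  A Dirichlet series is represented by its coefficient sequence \<open>a :: nat \<Rightarrow> complex\<close>.
  Only the values \<open>a n\<close> with \<open>n \<ge> 1\<close> are ever used; \<open>a 0\<close> is irrelevant.
\<close>

text \<open>
  Abscissae are extended reals: the infimum of the empty set is \<open>\<infinity>\<close>, that of all of the reals
  is \<open>-\<infinity>\<close>. Since the difference of two extended reals is a real number only if both of them
  are, an equation \<open>abs_abscissa a - smooth_abscissa a = ereal r\<close> says in particular that
  both abscissae are finite.
\<close>

definition abs_abscissa :: "(nat \<Rightarrow> complex) \<Rightarrow> ereal" where
  "abs_abscissa a =
     Inf (ereal ` {\<sigma>::real. (\<lambda>n. cmod (a n) * real n powr (-\<sigma>)) summable_on {n. n \<ge> 1}})"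

text \<open>The library function \<open>enumerate\<close> counts from 0, so \<open>nth_prime 1 = 2\<close>, \<open>nth_prime 2 = 3\<close>.\<close>

definition nth_prime :: "nat \<Rightarrow> nat" where
  "nth_prime n = enumerate {p::nat. prime p} (n - 1)"

definition gpf :: "nat \<Rightarrow> nat" where
  "gpf n = (if n = 1 then 1 else Max (prime_factors n))"

definition smooth_abscissa :: "(nat \<Rightarrow> complex) \<Rightarrow> ereal" where
  "smooth_abscissa a =
     Inf (ereal ` {\<sigma>::real. \<forall>n\<ge>1.
       (\<lambda>j. cmod (a j) * real j powr (-\<sigma>)) summable_on {j. j \<ge> 1 \<and> gpf j \<le> nth_prime n}})"

definition multiplicative_coeffs :: "(nat \<Rightarrow> complex) \<Rightarrow> bool" where
  "multiplicative_coeffs a \<longleftrightarrow>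
     (\<forall>m n. m \<ge> 1 \<longrightarrow> n \<ge> 1 \<longrightarrow> gcd m n = 1 \<longrightarrow> a (m * n) = a m * a n)"

end

theory Submission
  imports Defs "HOL-Computational_Algebra.Squarefree"
begin

text \<open>
  Write \<open>rad n\<close> for the product of the primes dividing \<open>n\<close>. On numbers with prime factors in a
  fixed finite set, \<open>rad\<close> is bounded, so the coefficients \<open>rad n powr (r - 1)\<close>, which are
  multiplicative, have \<open>\<delta>\<^sub>a = 0\<close>. On squarefree \<open>n\<close> they are \<open>n powr (r - 1)\<close>, and the sum of
  \<open>n powr - s\<close> over squarefree \<open>n\<close> diverges for \<open>s < 1\<close>: otherwise, for \<open>1/2 < s < 1\<close>,
  multiplying by the sum of \<open>m powr - (2 * s)\<close> would bound the sum over all \<open>n\<close>. Hence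
  \<open>\<sigma>\<^sub>a = r\<close> if \<open>r \<ge> 1\<close>. For \<open>0 \<le> r < 1\<close> the coefficients \<open>1\<close> on the powers of two
  and \<open>n powr (r - 1)\<close> elsewhere have \<open>\<delta>\<^sub>a = 0\<close> and \<open>\<sigma>\<^sub>a = r\<close>.
\<close>

section \<open>Abscissae and summability\<close>

text \<open>Nothing is assumed at \<open>x\<close> itself, so convergence on the boundary of a
  half-plane never has to be decided.\<close>

lemma Inf_ereal_image_eqI:
  assumes "\<And>s. x < s \<Longrightarrow> s \<in> S" and "\<And>s. s < x \<Longrightarrow> s \<notin> S"
  shows "Inf (ereal ` S) = ereal x"
proof (rule antisym)
  show "Inf (ereal ` S) \<le> ereal x"
  proof (rule dense_ge)
    fix y assume "ereal x < y"
    then obtain z where z: "ereal x < ereal z" "ereal z < y"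
      using ereal_dense2 by blast
    then have "ereal z \<in> ereal ` S" using assms(1) by simp
    then have "Inf (ereal ` S) \<le> ereal z" by (rule Inf_lower)
    with z(2) show "Inf (ereal ` S) \<le> y" by simp
  qed
  show "ereal x \<le> Inf (ereal ` S)"
    using assms(2) by (force intro!: Inf_greatest simp: not_less[symmetric])
qed

lemma summable_on_mult_Times:
  fixes f :: "'a \<Rightarrow> real" and g :: "'b \<Rightarrow> real"
  assumes "f summable_on A" "g summable_on B"
    and "\<And>x. x \<in> A \<Longrightarrow> 0 \<le> f x" "\<And>y. y \<in> B \<Longrightarrow> 0 \<le> g y"
  shows "(\<lambda>(x, y). f x * g y) summable_on A \<times> B"
proof (rule summable_on_SigmaI)
  show "((\<lambda>y. case (x, y) of (x, y) \<Rightarrow> f x * g y) has_sum f x * infsum g B) B" for x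
    using assms(2) by (auto intro: has_sum_cmult_right)
  show "(\<lambda>x. f x * infsum g B) summable_on A"
    using assms(1) by (rule summable_on_cmult_left)
qed (use assms in auto)

lemma summable_on_powr_iff:
  "(\<lambda>n. real n powr (- s)) summable_on {n. n \<ge> 1} \<longleftrightarrow> 1 < s"
proof -
  have "(\<lambda>n. real n powr (- s)) summable_on {n. n \<ge> 1} \<longleftrightarrow>
      (\<lambda>n. real n powr (- s)) summable_on UNIV"
    \<comment> \<open>The added index 0 contributes nothing, since
      \<open>0 powr _ = 0\<close>.\<close>
    by (rule summable_on_cong_neutral) (auto simp: not_le)
  also have "\<dots> \<longleftrightarrow> summable (\<lambda>n. real n powr (- s))"
    by (rule summable_on_UNIV_nonneg_real_iff) simp
  also have "\<dots> \<longleftrightarrow> 1 < s"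
    using summable_real_powr_iff[of "- s"] by simp
  finally show ?thesis .
qed

text \<open>Along the powers of \<open>p\<close> the terms stay at least 1, so they do not tend to
  0.\<close>

lemma not_summable_on_powers:
  fixes f :: "nat \<Rightarrow> real"
  assumes "2 \<le> p" "range (\<lambda>k. p ^ k) \<subseteq> A" "\<And>k. 1 \<le> f (p ^ k)"
  shows "\<not> f summable_on A"
proof
  assume "f summable_on A"
  then have "f summable_on range (\<lambda>k. p ^ k)"
    using assms(2) by (rule summable_on_subset)
  moreover have "inj (\<lambda>k. p ^ k)"
    using assms(1) by (auto intro!: injI)
  ultimately have "(\<lambda>k. f (p ^ k)) summable_on UNIV"
    by (simp add: summable_on_reindex o_def)
  then have "(\<lambda>k. f (p ^ k)) \<longlonglongrightarrow> 0"
    by (intro summable_LIMSEQ_zero summable_on_imp_summable)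
  then have "1 \<le> (0::real)"
    by (rule LIMSEQ_le_const) (use assms(3) in blast)
  then show False by simp
qed

section \<open>Smooth numbers\<close>

text \<open>A finite Euler product, built one prime at a time. Adjoining \<open>p\<close> multiplies
  the sum by the geometric series of ratio \<open>p powr (- s)\<close>, which is below 1 because
  \<open>s\<close> is positive.\<close>

lemma summable_on_smooth:
  fixes s :: real
  assumes "finite P" "\<And>p. p \<in> P \<Longrightarrow> prime p" "0 < s"
  shows "(\<lambda>j. real j powr (- s)) summable_on {j. j \<ge> 1 \<and> prime_factors j \<subseteq> P}"
  using assms(1,2)
proof (induction P)
  case empty
  have "{j::nat. j \<ge> 1 \<and> prime_factors j \<subseteq> {}} = {1}"
    by (auto simp: prime_factorization_empty_iff)
  then show ?case by simp
next
  case (insert p P)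
  let ?S = "{j. j \<ge> 1 \<and> prime_factors j \<subseteq> P}"
  let ?h = "\<lambda>(k::nat, j::nat). p ^ k * j"
  have p: "prime p" using insert.prems by simp
  then have p1: "1 < p" by (rule prime_gt_1_nat)
  have ndvd: "\<not> p dvd j" if "j \<in> ?S" for j
    using that p insert.hyps(2) by (auto simp: prime_factors_dvd)
  have "(\<lambda>k. (real p powr (- s)) ^ k) summable_on UNIV"
    using p1 \<open>0 < s\<close>
    by (subst summable_on_UNIV_nonneg_real_iff)
       (auto intro!: summable_geometric simp: powr_minus inverse_less_1_iff
          less_imp_le intro: gr_one_powr)
  with insert have "(\<lambda>(k, j). (real p powr (- s)) ^ k * real j powr (- s)) summable_on UNIV \<times> ?S"
    by (intro summable_on_mult_Times) auto
  also have "(\<lambda>(k, j). (real p powr (- s)) ^ k * real j powr (- s))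
      = (\<lambda>j. real j powr (- s)) \<circ> ?h"
    using p1 by (auto simp: fun_eq_iff powr_mult powr_powr powr_realpow[symmetric] powr_power mult.commute)
  also have "\<dots> summable_on UNIV \<times> ?S \<longleftrightarrow>
      (\<lambda>j. real j powr (- s)) summable_on ?h ` (UNIV \<times> ?S)"
  \<comment> \<open>As \<open>p\<close> does not divide \<open>j\<close>, the exponent
    \<open>k\<close> is the multiplicity of \<open>p\<close> in \<open>p ^ k * j\<close>, which then
    determines \<open>j\<close>.\<close>
  proof (rule summable_on_reindex[symmetric], rule inj_onI, clarify)
    fix k j k' j' assume "p ^ k * j = p ^ k' * j'" "1 \<le> j" "1 \<le> j'"
      "prime_factors j \<subseteq> P" "prime_factors j' \<subseteq> P"
    moreover from this have "\<not> p dvd j" "\<not> p dvd j'" using ndvd by auto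
    ultimately show "k = k' \<and> j = j'"
      using p1 multiplicity_decomposeI[of "p ^ k * j" p k j] 
        multiplicity_decomposeI[of "p ^ k * j" p k' j'] p by auto
  qed
  also have "?h ` (UNIV \<times> ?S) = {j. j \<ge> 1 \<and> prime_factors j \<subseteq> insert p P}"
  proof (intro equalityI subsetI)
    fix n assume "n \<in> ?h ` (UNIV \<times> ?S)"
    then obtain k j where n: "n = p ^ k * j" and j: "j \<in> ?S" by auto
    have "prime_factors n \<subseteq> insert p (prime_factors j)"
      using p p1 j
      by (auto simp: n prime_factorization_mult prime_factorization_prime_power split: if_splits)
    then show "n \<in> {j. j \<ge> 1 \<and> prime_factors j \<subseteq> insert p P}"
      using j n p1 by auto
  next
    fix n assume n: "n \<in> {j. j \<ge> 1 \<and> prime_factors j \<subseteq> insert p P}"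
    then obtain j where j: "n = p ^ multiplicity p n * j" "\<not> p dvd j"
      using p1 multiplicity_decompose'[of n p] by auto
    have "prime_factors j \<subseteq> prime_factors n"
      using n dvd_triv_right[of j "p ^ multiplicity p n"] j(1) by (intro dvd_prime_factors) auto
    moreover have "p \<notin> prime_factors j" using j(2) by auto
    moreover have "j \<ge> 1" using j(2) by (cases j) auto
    ultimately have "j \<in> ?S" using n by blast
    then show "n \<in> ?h ` (UNIV \<times> ?S)"
      using j(1) by force
  qed
  finally show ?case .
qed

lemma prime_nth_prime: "prime (nth_prime n)"
  using enumerate_in_set[OF primes_infinite] by (simp add: nth_prime_def)

lemma prime_factors_subset_of_gpf_le:
  assumes "gpf j \<le> N"
  shows "prime_factors j \<subseteq> {p. prime p \<and> p \<le> N}"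
proof
  fix p assume p: "p \<in> prime_factors j"
  then have "p \<le> Max (prime_factors j)" by (intro Max_ge) auto
  \<comment> \<open>Having a prime factor excludes \<open>j = 1\<close>, where \<open>gpf\<close>
    takes its conventional value.\<close>
  also have "\<dots> = gpf j" using p by (auto simp: gpf_def)
  finally show "p \<in> {p. prime p \<and> p \<le> N}"
    using assms p by auto
qed

lemma gpf_power_two_le: "gpf (2 ^ k) \<le> 2"
  by (cases k) (auto simp: gpf_def prime_factorization_prime_power simp del: power_Suc)

text \<open>Bounded coefficients on smooth numbers allow comparison with the finite Euler product
  for every positive \<open>s\<close>. For negative \<open>s\<close> the powers of two, which are
  smooth for every bound, already give terms of size at least 1.\<close>

lemma smooth_abscissa_eq_0:
  assumes two: "\<And>k. 1 \<le> cmod (a (2 ^ k))"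
    and bdd: "\<And>N. \<exists>C. \<forall>j\<ge>1. prime_factors j \<subseteq> {p. prime p \<and> p \<le> N} \<longrightarrow> cmod (a j) \<le> C"
  shows "smooth_abscissa a = 0"
  unfolding smooth_abscissa_def zero_ereal_def
proof (rule Inf_ereal_image_eqI; clarify?)
  fix s :: real and n :: nat assume "0 < s"
  define P where "P = {p. prime p \<and> p \<le> nth_prime n}"
  obtain C where C: "cmod (a j) \<le> C" if "j \<ge> 1" "prime_factors j \<subseteq> P" for j
    using bdd unfolding P_def by meson
  have "finite P" unfolding P_def by simp
  then have "(\<lambda>j. C * real j powr (- s)) summable_on {j. j \<ge> 1 \<and> prime_factors j \<subseteq> P}"
    using \<open>0 < s\<close> by (intro summable_on_cmult_right summable_on_smooth) (auto simp: P_def)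
  then have "(\<lambda>j. C * real j powr (- s)) summable_on {j. j \<ge> 1 \<and> gpf j \<le> nth_prime n}"
    by (rule summable_on_subset) (use prime_factors_subset_of_gpf_le in \<open>auto simp: P_def\<close>)
  then show "(\<lambda>j. cmod (a j) * real j powr (- s)) summable_on {j. j \<ge> 1 \<and> gpf j \<le> nth_prime n}"
    by (rule summable_on_comparison_test)
       (use C prime_factors_subset_of_gpf_le in \<open>auto simp: P_def intro!: mult_right_mono\<close>)
next
  fix s :: real assume "s < 0"
    and "\<forall>n\<ge>1. (\<lambda>j. cmod (a j) * real j powr (- s)) summable_on {j. j \<ge> 1 \<and> gpf j \<le> nth_prime n}"
  moreover have "\<not> (\<lambda>j. cmod (a j) * real j powr (- s)) summable_on
      {j. j \<ge> 1 \<and> gpf j \<le> nth_prime 1}"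
  proof (rule not_summable_on_powers[of 2])
    show "range (\<lambda>k. 2 ^ k) \<subseteq> {j. j \<ge> 1 \<and> gpf j \<le> nth_prime 1}"
      using gpf_power_two_le prime_ge_2_nat[OF prime_nth_prime] order_trans by auto blast
    show "1 \<le> cmod (a (2 ^ k)) * real (2 ^ k) powr (- s)" for k
      using two[of k] \<open>s < 0\<close> ge_one_powr_ge_zero[of "2 ^ k" "- s"]
      by (simp add: mult_ge1_I)
  qed simp
  ultimately show False by simp
qed

section \<open>Powers of the radical\<close>

definition rad :: "nat \<Rightarrow> nat" where
  "rad n = \<Prod>(prime_factors n)"

lemma rad_ge_1: "1 \<le> rad n"
  unfolding rad_def by (rule prod_ge_1) (use in_prime_factors_imp_prime prime_ge_1_nat in blast)

lemma rad_le: assumes "n \<ge> 1" shows "rad n \<le> n"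
proof -
  have "rad n \<le> (\<Prod>p\<in>prime_factors n. p ^ multiplicity p n)"
    unfolding rad_def
    by (rule prod_mono) (auto intro!: self_le_power prime_ge_1_nat[simplified] simp: prime_factors_multiplicity)
  also have "\<dots> = n" using assms by (simp add: prod_prime_factors)
  finally show ?thesis .
qed

lemma rad_squarefree: assumes "squarefree n" shows "rad n = n"
proof -
  have "n \<noteq> 0" using assms not_squarefree_0 by metis
  then have "n = (\<Prod>p\<in>prime_factors n. p ^ multiplicity p n)"
    by (simp add: prod_prime_factors)
  also have "\<dots> = rad n"
    using assms \<open>n \<noteq> 0\<close> unfolding rad_def
    by (intro prod.cong) (auto simp: squarefree_factorial_semiring')
  finally show ?thesis ..
qed

lemma rad_mult:
  assumes "m \<ge> 1" "n \<ge> 1" "coprime m n"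
  shows "rad (m * n) = rad m * rad n"
proof -
  have "prime_factors m \<inter> prime_factors n = {}"
    using assms(3) by (auto simp: prime_factors_dvd dest: coprime_common_divisor not_prime_unit)
  then show ?thesis
    using assms(1,2) by (simp add: rad_def prime_factors_product prod.union_disjoint)
qed

lemma not_summable_on_squarefree:
  fixes s :: real
  assumes "s < 1"
  shows "\<not> (\<lambda>n. real n powr (- s)) summable_on {n. squarefree n}"
proof
  assume *: "(\<lambda>n. real n powr (- s)) summable_on {n. squarefree n}"
  \<comment> \<open>Raising the exponent keeps the series convergent. Any constant strictly between
    1/2 and 1 would do for 3/4: the series over squares needs \<open>2 * t\<close> above 1, and the
    contradiction needs \<open>t\<close> below 1.\<close>
  define t where "t = max s (3/4)"
  have t: "s \<le> t" "1 < 2 * t" "t < 1" using assms by (auto simp: t_def)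
  have "(\<lambda>n. real n powr (- t)) summable_on {n. squarefree n}"
    using *
  proof (rule summable_on_comparison_test)
    fix n :: nat assume "n \<in> {n. squarefree n}"
    then have "1 \<le> real n" by (cases n) auto
    then show "real n powr (- t) \<le> real n powr (- s)" using t by (intro powr_mono) auto
  qed simp
  then have "(\<lambda>(q, m). real q powr (- t) * real m powr (- (2 * t)))
      summable_on {n. squarefree n} \<times> {m. m \<ge> 1}"
    using summable_on_powr_iff[of "2 * t"] t by (intro summable_on_mult_Times) auto
  \<comment> \<open>Writing \<open>n\<close> as a squarefree number times a square is unique, so the
    positive integers embed into the index set of the product series.\<close>
  moreover define h where "h = (\<lambda>n::nat. (squarefree_part n, square_part n))"
  moreover have "h ` {n. n \<ge> 1} \<subseteq> {n. squarefree n} \<times> {m. m \<ge> 1}"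
    by (auto simp: h_def Suc_le_eq simp flip: neq0_conv)
  ultimately have "(\<lambda>(q, m). real q powr (- t) * real m powr (- (2 * t))) summable_on h ` {n. n \<ge> 1}"
    using summable_on_subset by blast
  moreover have "inj_on h {n. n \<ge> 1}"
    by (auto simp: h_def inj_on_def intro: squarefree_decomposition_unique)
  ultimately have "(\<lambda>n. real (squarefree_part n) powr (- t) * real (square_part n) powr (- (2 * t)))
      summable_on {n. n \<ge> 1}"
    by (simp add: summable_on_reindex o_def h_def)
  also have "?this \<longleftrightarrow> (\<lambda>n. real n powr (- t)) summable_on {n. n \<ge> 1}"
  proof (rule summable_on_cong)
    fix n :: nat
    have "real n = real (squarefree_part n) * real (square_part n) ^ 2"
      by (metis squarefree_decompose of_nat_mult of_nat_power)
    then have "real n powr (- t) =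
        (real (squarefree_part n) * real (square_part n) ^ 2) powr (- t)" by simp
    also have "\<dots> = real (squarefree_part n) powr (- t) * real (square_part n) powr (- (2 * t))"
      \<comment> \<open>The first case is \<open>n = 0\<close>, where both sides vanish.\<close>
      by (cases "square_part n = 0")
         (auto simp: powr_mult powr_powr powr_realpow[symmetric] simp flip: powr_numeral)
    finally show "real (squarefree_part n) powr (- t) * real (square_part n) powr (- (2 * t))
        = real n powr (- t)" ..
  qed
  finally show False using t summable_on_powr_iff[of t] by simp
qed

text \<open>Since \<open>rad n\<close> is at most \<open>n\<close>, the series is dominated by that
  of \<open>n powr (c - s)\<close>; on squarefree \<open>n\<close> the terms agree, and those alone
  diverge for \<open>s\<close> below \<open>c + 1\<close>.\<close>

lemma abs_abscissa_rad_powr: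
  assumes "0 \<le> c"
  shows "abs_abscissa (\<lambda>n. of_real (real (rad n) powr c)) = ereal (c + 1)"
  unfolding abs_abscissa_def
proof (rule Inf_ereal_image_eqI; clarify?)
  fix s :: real assume "c + 1 < s"
  then have "(\<lambda>n. real n powr (- (s - c))) summable_on {n. n \<ge> 1}"
    using summable_on_powr_iff[of "s - c"] by simp
  then show "(\<lambda>n. cmod (of_real (real (rad n) powr c)) * real n powr (- s)) summable_on {n. n \<ge> 1}"
  proof (rule summable_on_comparison_test)
    fix n :: nat assume "n \<in> {n. n \<ge> 1}"
    then have "real (rad n) powr c * real n powr (- s) \<le> real n powr c * real n powr (- s)"
      using rad_le[of n] assms by (intro mult_right_mono powr_mono2) auto
    then show "cmod (of_real (real (rad n) powr c)) * real n powr (- s) \<le> real n powr (- (s - c))"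
      by (simp flip: powr_add)
  qed simp
next
  fix s :: real assume "s < c + 1"
    and "(\<lambda>n. cmod (of_real (real (rad n) powr c)) * real n powr (- s)) summable_on {n. n \<ge> 1}"
  then have "(\<lambda>n. cmod (of_real (real (rad n) powr c)) * real n powr (- s))
      summable_on {n. squarefree n}"
    by (elim summable_on_subset) (auto simp: Suc_le_eq intro: Nat.gr0I)
  also have "?this \<longleftrightarrow> (\<lambda>n. real n powr (- (s - c))) summable_on {n. squarefree n}"
    by (rule summable_on_cong) (simp add: rad_squarefree flip: powr_add)
  finally show False using not_summable_on_squarefree[of "s - c"] \<open>s < c + 1\<close> by simp
qed

lemma smooth_abscissa_rad_powr:
  assumes "0 \<le> c"
  shows "smooth_abscissa (\<lambda>n. of_real (real (rad n) powr c)) = 0"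
proof (rule smooth_abscissa_eq_0)
  show "1 \<le> cmod (of_real (real (rad (2 ^ k)) powr c))" for k
    using rad_ge_1[of "2 ^ k"] assms by (simp add: ge_one_powr_ge_zero)
  fix N :: nat
  define P where "P = {p. prime p \<and> p \<le> N}"
  \<comment> \<open>The radical ignores exponents, so the product of all primes up to
    \<open>N\<close> bounds it uniformly in \<open>j\<close>.\<close>
  have "cmod (of_real (real (rad j) powr c)) \<le> real (\<Prod>P) powr c" if "prime_factors j \<subseteq> P" for j
  proof -
    have "\<Prod>P > 0" by (auto simp: P_def intro!: prod_pos prime_gt_0_nat)
    moreover have "rad j dvd \<Prod>P"
      unfolding rad_def using that by (intro prod_dvd_prod_subset) (auto simp: P_def)
    ultimately have "rad j \<le> \<Prod>P" by (simp add: dvd_imp_le)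
    then have "real (rad j) \<le> real (\<Prod>P)" by (simp only: of_nat_le_iff)
    then show ?thesis using assms by (simp add: powr_mono2 del: of_nat_prod)
  qed
  then show "\<exists>C. \<forall>j\<ge>1. prime_factors j \<subseteq> {p. prime p \<and> p \<le> N} \<longrightarrow>
      cmod (of_real (real (rad j) powr c)) \<le> C"
    unfolding P_def by blast
qed

section \<open>Differences below one\<close>

text \<open>The coefficients \<open>n powr c\<close> alone have abscissae \<open>c + 1\<close> and
  \<open>c\<close>, always 1 apart. For \<open>c\<close> between -1 and 0, putting 1 on the powers
  of two lifts the second to 0 and leaves the first unchanged.\<close>

definition two_power_coeff :: "real \<Rightarrow> nat \<Rightarrow> real" where
  "two_power_coeff c n = (if n \<in> range (\<lambda>k. 2 ^ k) then 1 else real n powr c)"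

lemma two_power_coeff_pos: "n \<ge> 1 \<Longrightarrow> 0 < two_power_coeff c n"
  by (simp add: two_power_coeff_def)

lemma two_power_coeff_le_1: "c \<le> 0 \<Longrightarrow> n \<ge> 1 \<Longrightarrow> two_power_coeff c n \<le> 1"
  using powr_mono[of c 0 "real n"] by (simp add: two_power_coeff_def)

lemma smooth_abscissa_two_power_coeff:
  assumes "c \<le> 0"
  shows "smooth_abscissa (\<lambda>n. of_real (two_power_coeff c n)) = 0"
proof (rule smooth_abscissa_eq_0)
  show "1 \<le> cmod (of_real (two_power_coeff c (2 ^ k)))" for k
    by (simp add: two_power_coeff_def)
  show "\<exists>C. \<forall>j\<ge>1. prime_factors j \<subseteq> {p. prime p \<and> p \<le> N} \<longrightarrow>
      cmod (of_real (two_power_coeff c j)) \<le> C" for N :: nat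
    using two_power_coeff_le_1[OF assms] two_power_coeff_pos
    by (intro exI[of _ 1]) (auto simp: less_imp_le)
qed

lemma abs_abscissa_two_power_coeff:
  assumes "-1 \<le> c" "c \<le> 0"
  shows "abs_abscissa (\<lambda>n. of_real (two_power_coeff c n)) = ereal (c + 1)"
  unfolding abs_abscissa_def
proof (rule Inf_ereal_image_eqI; clarify?)
  fix s :: real assume s: "c + 1 < s"
  let ?T = "range (\<lambda>k. 2 ^ k) :: nat set"
  let ?f = "\<lambda>n. cmod (of_real (two_power_coeff c n)) * real n powr (- s)"
  \<comment> \<open>Here \<open>-1 \<le> c\<close> enters: it makes \<open>s\<close> positive, so
    the series over the powers of two converges.\<close>
  have "(\<lambda>n. real n powr (- s)) summable_on {j. j \<ge> 1 \<and> prime_factors j \<subseteq> {2}}"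
    using s assms by (intro summable_on_smooth) auto
  then have "(\<lambda>n. real n powr (- s)) summable_on ?T"
    by (rule summable_on_subset) (auto simp: prime_factorization_prime_power split: if_splits)
  also have "?this \<longleftrightarrow> ?f summable_on ?T"
    by (rule summable_on_cong) (auto simp: two_power_coeff_def)
  finally have T: "?f summable_on ?T" .
  have "(\<lambda>n. real n powr (- (s - c))) summable_on {n. n \<ge> 1}"
    using s summable_on_powr_iff[of "s - c"] by simp
  then have "(\<lambda>n. real n powr (- (s - c))) summable_on {n. n \<ge> 1} - ?T"
    by (rule summable_on_subset) auto
  also have "?this \<longleftrightarrow> ?f summable_on {n. n \<ge> 1} - ?T"
    by (rule summable_on_cong) (simp add: two_power_coeff_def flip: powr_add)
  finally have "?f summable_on ?T \<union> ({n. n \<ge> 1} - ?T)"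
    using T by (intro summable_on_Un_disjoint) auto
  then show "?f summable_on {n. n \<ge> 1}"
    by (rule summable_on_subset) auto
next
  fix s :: real assume s: "s < c + 1"
    and "(\<lambda>n. cmod (of_real (two_power_coeff c n)) * real n powr (- s)) summable_on {n. n \<ge> 1}"
  from this(2) have "(\<lambda>n. real n powr (- (s - c))) summable_on {n. n \<ge> 1}"
  proof (rule summable_on_comparison_test)
    fix n :: nat assume "n \<in> {n. n \<ge> 1}"
    \<comment> \<open>As \<open>c \<le> 0\<close>, the modified values on the powers of two only
      increase, so the divergent series is still a lower bound.\<close>
    then have "real n powr c \<le> two_power_coeff c n"
      using powr_mono[of c 0 "real n"] assms by (auto simp: two_power_coeff_def)
    then have "real n powr c * real n powr (- s) \<le> \<bar>two_power_coeff c n\<bar> * real n powr (- s)"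
      by (intro mult_right_mono) auto
    then show "real n powr (- (s - c)) \<le> cmod (of_real (two_power_coeff c n)) * real n powr (- s)"
      by (simp flip: powr_add)
  qed simp
  then show False using s summable_on_powr_iff[of "s - c"] by simp
qed

theorem theorem1p2:
  shows "(\<forall>r::real. r \<ge> 0 \<longrightarrow>
            (\<exists>a::nat \<Rightarrow> complex. (\<forall>n\<ge>1. a n \<in> \<real> \<and> Re (a n) > 0) \<and>
               abs_abscissa a - smooth_abscissa a = ereal r)) \<and>
         (\<forall>r::real. r \<ge> 1 \<longrightarrow>
            (\<exists>a::nat \<Rightarrow> complex. multiplicative_coeffs a \<and>
               abs_abscissa a - smooth_abscissa a = ereal r))"
proof (intro conjI allI impI)
  fix r :: real assume "1 \<le> r"
  then have "abs_abscissa (\<lambda>n. of_real (real (rad n) powr (r - 1)))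
      - smooth_abscissa (\<lambda>n. of_real (real (rad n) powr (r - 1))) = ereal r"
    by (simp add: abs_abscissa_rad_powr smooth_abscissa_rad_powr)
  moreover have "multiplicative_coeffs (\<lambda>n. of_real (real (rad n) powr (r - 1)))"
    by (simp add: multiplicative_coeffs_def rad_mult powr_mult coprime_iff_gcd_eq_1)
  ultimately show "\<exists>a. multiplicative_coeffs a \<and> abs_abscissa a - smooth_abscissa a = ereal r"
    by blast
next
  fix r :: real assume "0 \<le> r"
  \<comment> \<open>The radical example is positive and serves again when \<open>r \<ge> 1\<close>.
    Below 1 its exponent \<open>r - 1\<close> would be negative, and \<open>two_power_coeff\<close>
    takes over.\<close>
  show "\<exists>a. (\<forall>n\<ge>1. a n \<in> \<real> \<and> Re (a n) > 0) \<and> abs_abscissa a - smooth_abscissa a = ereal r"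
  proof (cases "1 \<le> r")
    case True
    then have "abs_abscissa (\<lambda>n. of_real (real (rad n) powr (r - 1)))
        - smooth_abscissa (\<lambda>n. of_real (real (rad n) powr (r - 1))) = ereal r"
      by (simp add: abs_abscissa_rad_powr smooth_abscissa_rad_powr)
    moreover have "0 < real (rad n) powr (r - 1)" for n
      using rad_ge_1[of n] by simp
    ultimately show ?thesis
      by (intro exI[of _ "\<lambda>n. of_real (real (rad n) powr (r - 1))"]) simp
  next
    case False
    with \<open>0 \<le> r\<close> have "abs_abscissa (\<lambda>n. of_real (two_power_coeff (r - 1) n))
        - smooth_abscissa (\<lambda>n. of_real (two_power_coeff (r - 1) n)) = ereal r"
      by (simp add: abs_abscissa_two_power_coeff smooth_abscissa_two_power_coeff)
    then show ?thesis
      by (intro exI[of _ "\<lambda>n. of_real (two_power_coeff (r - 1) n)"])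
         (simp add: two_power_coeff_pos)
  qed
qed

end
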